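(* Let $T>0$, $\ell> 0$, $\tau\in\mathbb{R}$, $\delta x>0$, $\rho_e>0$, and $N\ge 2$. Let $V(\rho)=\frac1T\big(\frac1\rho-\ell\big)$ and $G(x,y)=\frac1T(1-y\ell)$, and consider, on $N$ cells with periodic boundary conditions (indices modulo $N$) and with time step $\delta t>0$, the schemes $$\rho_i(t+\delta t)=\rho_i(t)+\frac{\delta t}{\delta x}\big(f_{i-1}(t)-f_i(t)\big)$$ where $f_i$ is either the Godunov/Godunov flow $$f_i^{(2)}=G(\rho_i,\rho_{i+1})+\frac{\tau}{\delta x}\,\rho_iV'(\rho_i)\big[G(\rho_{i+1},\rho_{i+2})-G(\rho_i,\rho_{i+1})\big],$$ or the Godunov flow $$f_i^{(3)}=G\left(\frac{\rho_i}{1-\frac{\tau}{\delta x}\big(V(\rho_{i+1})-V(\rho_i)\big)},\ \frac{\rho_{i+1}}{1-\frac{\tau}{\delta x}\big(V(\rho_{i+2})-V(\rho_{i+1})\big)}\right).$$ If $$2|\tau|<T\,\delta x\,\rho_e,$$ and if $\delta t$ is sufficiently small (i.e. for all $\delta t\in(0,\delta t_0)$ for some $\delta t_0>0$), then for each of these two schemes the homogeneous configuration $\rho_i(t)=\rho_e$ for all $i$ and $t$ is linearly stable.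
   Context: $T$ is the vehicles' time gap, $\ell$ the vehicle size, $\tau$ the reaction (or, if negative, anticipation) time, $V$ the optimal speed as a function of the density, and $G$ is the Godunov flux associated with the flow $\rho V(\rho)$ for this $V$. Linear stability: writing the scheme as $\rho_i(t+\delta t)=F(\rho_i(t),\rho_{i+1}(t),\rho_{i+2}(t),\rho_{i-1}(t))$ (defined near the homogeneous configuration), let $\alpha,\beta,\gamma,\xi$ be the partial derivatives of $F$ with respect to $\rho_i,\rho_{i+1},\rho_{i+2},\rho_{i-1}$ respectively, evaluated at $(\rho_e,\rho_e,\rho_e,\rho_e)$. The linearised system for the perturbations $\varepsilon_i=\rho_i-\rho_e$ is $$\varepsilon_i(t+\delta t)=\alpha\,\varepsilon_i(t)+\beta\,\varepsilon_{i+1}(t)+\gamma\,\varepsilon_{i+2}(t)+\xi\,\varepsilon_{i-1}(t),\qquad i\in\mathbb{Z}/N\mathbb{Z}.$$ The scheme conserves the total mass $\sum_i\rho_i$. The homogeneous configuration is called linearly stable if every solution of the linearised system whose initial perturbation satisfies $\sum_i\varepsilon_i(0)=0$ tends to $0$ as the number of time steps tends to infinity. *)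

theory Defs
  imports "HOL-Analysis.Analysis"
begin

definition optimal_speed :: "real \<Rightarrow> real \<Rightarrow> real \<Rightarrow> real" where
  "optimal_speed T l \<rho> = (1 / T) * (1 / \<rho> - l)"

text \<open>The first argument is the upstream and the second the downstream density; the flow
  \<open>\<rho> V(\<rho>) = (1 - \<rho> l) / T\<close> is decreasing, so the Godunov flux only depends on the latter.\<close>

definition godunov_flux :: "real \<Rightarrow> real \<Rightarrow> real \<Rightarrow> real \<Rightarrow> real" where
  "godunov_flux T l x y = (1 / T) * (1 - y * l)"

text \<open>In both flows below \<open>x\<close>, \<open>y\<close>, \<open>z\<close> stand for the densities
  \<open>\<rho>\<^sub>i\<close>, \<open>\<rho>\<^sub>i\<^sub>+\<^sub>1\<close>, \<open>\<rho>\<^sub>i\<^sub>+\<^sub>2\<close>.\<close>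

definition godunov_godunov_flow ::
  "(real \<Rightarrow> real) \<Rightarrow> (real \<Rightarrow> real \<Rightarrow> real) \<Rightarrow> real \<Rightarrow> real \<Rightarrow> real \<Rightarrow> real \<Rightarrow> real \<Rightarrow> real" where
  "godunov_godunov_flow V G \<tau> \<delta>x x y z =
     G x y + \<tau> / \<delta>x * (x * deriv V x) * (G y z - G x y)"

definition godunov_flow ::
  "(real \<Rightarrow> real) \<Rightarrow> (real \<Rightarrow> real \<Rightarrow> real) \<Rightarrow> real \<Rightarrow> real \<Rightarrow> real \<Rightarrow> real \<Rightarrow> real \<Rightarrow> real" where
  "godunov_flow V G \<tau> \<delta>x x y z =
     G (x / (1 - \<tau> / \<delta>x * (V y - V x))) (y / (1 - \<tau> / \<delta>x * (V z - V y)))"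

text \<open>\<open>scheme_map f \<delta>t \<delta>x a b c d\<close> is \<open>\<rho>\<^sub>i(t + \<delta>t)\<close> as a function of
  \<open>a = \<rho>\<^sub>i(t)\<close>, \<open>b = \<rho>\<^sub>i\<^sub>+\<^sub>1(t)\<close>, \<open>c = \<rho>\<^sub>i\<^sub>+\<^sub>2(t)\<close>, \<open>d = \<rho>\<^sub>i\<^sub>-\<^sub>1(t)\<close>, where
  \<open>f\<^sub>i = f \<rho>\<^sub>i \<rho>\<^sub>i\<^sub>+\<^sub>1 \<rho>\<^sub>i\<^sub>+\<^sub>2\<close>.\<close>

definition scheme_map ::
  "(real \<Rightarrow> real \<Rightarrow> real \<Rightarrow> real) \<Rightarrow> real \<Rightarrow> real \<Rightarrow> real \<Rightarrow> real \<Rightarrow> real \<Rightarrow> real \<Rightarrow> real" where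
  "scheme_map f \<delta>t \<delta>x a b c d = a + \<delta>t / \<delta>x * (f d a b - f a b c)"

text \<open>Functions on \<open>\<int>/N\<int>\<close> are represented as \<open>N\<close>-periodic functions on the integers;
  \<open>\<epsilon> k i\<close> is the perturbation of cell \<open>i\<close> after \<open>k\<close> time steps.\<close>

definition linearised_solution ::
  "nat \<Rightarrow> real \<Rightarrow> real \<Rightarrow> real \<Rightarrow> real \<Rightarrow> (nat \<Rightarrow> int \<Rightarrow> real) \<Rightarrow> bool" where
  "linearised_solution N \<alpha> \<beta> \<gamma> \<xi> \<epsilon> \<longleftrightarrow>
     (\<forall>k i. \<epsilon> k (i + int N) = \<epsilon> k i) \<and>
     (\<forall>k i. \<epsilon> (Suc k) i =
        \<alpha> * \<epsilon> k i + \<beta> * \<epsilon> k (i + 1) + \<gamma> * \<epsilon> k (i + 2) + \<xi> * \<epsilon> k (i - 1))"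

text \<open>The partial derivatives are required to exist; they are then unique. The coefficients are
  those of \<open>F\<close> as a function of four independent variables, also when \<open>N \<le> 3\<close> and some of the
  four cells coincide.\<close>

definition linearly_stable ::
  "nat \<Rightarrow> (real \<Rightarrow> real \<Rightarrow> real \<Rightarrow> real \<Rightarrow> real) \<Rightarrow> real \<Rightarrow> bool" where
  "linearly_stable N F \<rho>e \<longleftrightarrow>
     (\<exists>\<alpha> \<beta> \<gamma> \<xi>.
        ((\<lambda>x. F x \<rho>e \<rho>e \<rho>e) has_real_derivative \<alpha>) (at \<rho>e) \<and>
        ((\<lambda>x. F \<rho>e x \<rho>e \<rho>e) has_real_derivative \<beta>) (at \<rho>e) \<and>
        ((\<lambda>x. F \<rho>e \<rho>e x \<rho>e) has_real_derivative \<gamma>) (at \<rho>e) \<and>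
        ((\<lambda>x. F \<rho>e \<rho>e \<rho>e x) has_real_derivative \<xi>) (at \<rho>e) \<and>
        (\<forall>\<epsilon>. linearised_solution N \<alpha> \<beta> \<gamma> \<xi> \<epsilon> \<and> (\<Sum>i = 0..<int N. \<epsilon> 0 i) = 0
           \<longrightarrow> (\<forall>i. (\<lambda>k. \<epsilon> k i) \<longlonglongrightarrow> 0)))"

end

theory Submission
  imports Defs "HOL-Library.Periodic_Fun"
begin

text \<open>
  At the homogeneous configuration \<open>\<rho>\<close> both flows have the same gradient, namely
  \<open>(0, - (l / T) (1 + q), (l / T) q)\<close> with \<open>q = \<tau> / (\<delta>x T \<rho>)\<close>. The first component vanishes
  because the flux ignores its upstream argument, and the correction by \<open>\<tau>\<close> enters
  the other two only through \<open>\<rho> V'(\<rho>) = - 1 / (T \<rho>)\<close>. Hence both schemes have one and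
  the same linearisation: with \<open>s = \<delta>t l / (\<delta>x T)\<close> and \<open>d\<^sub>i = \<epsilon>\<^sub>i - \<epsilon>\<^sub>i\<^sub>+\<^sub>1\<close>, one time step
  replaces \<open>\<epsilon>\<^sub>i\<close> by \<open>\<epsilon>\<^sub>i - s p\<^sub>i\<close>, where \<open>p\<^sub>i = (1 + q) d\<^sub>i - q d\<^sub>i\<^sub>+\<^sub>1\<close>. The hypothesis on
  \<open>\<tau>\<close> says exactly that \<open>2 \<bar>q\<bar> < 1\<close>.

  Decay follows from an energy estimate, which replaces the discussion of Fourier
  modes. Summing by parts over a period,
  \<open>2 (\<Sum>\<epsilon>\<^sub>i p\<^sub>i) = (\<Sum>d\<^sub>i\<^sup>2) - 2 q (\<Sum>d\<^sub>i d\<^sub>i\<^sub>+\<^sub>1) \<ge> (1 - 2 \<bar>q\<bar>) (\<Sum>d\<^sub>i\<^sup>2)\<close>, while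
  \<open>(\<Sum>p\<^sub>i\<^sup>2) \<le> 5 (\<Sum>d\<^sub>i\<^sup>2)\<close>. So a step lowers the energy \<open>\<Sum>\<epsilon>\<^sub>i\<^sup>2\<close> by at least
  \<open>s (1 - 2 \<bar>q\<bar> - 5 s) (\<Sum>d\<^sub>i\<^sup>2)\<close>, see \<open>energy_dissipation\<close>, and the factor is
  positive as soon as \<open>5 s < 1 - 2 \<bar>q\<bar>\<close>; this is where \<open>\<delta>t\<close> has to be small. Perturbations
  of total mass zero keep total mass zero, and for them \<open>\<Sum>d\<^sub>i\<^sup>2\<close> controls the energy
  by \<open>poincare_inequality_period\<close>, so the energy decays geometrically.
\<close>

section \<open>Sums over one period\<close>

lemma sum_period_shift:
  fixes u :: "int \<Rightarrow> real"
  assumes "\<And>i. u (i + int N) = u i"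
  shows "(\<Sum>i = 0..<int N. u (i + 1)) = (\<Sum>i = 0..<int N. u i)"
proof (cases "N = 0")
  case False
  have "(\<Sum>i = 0..<int N. u (i + 1)) = (\<Sum>i = 1..<int N + 1. u i)"
    by (rule sum.reindex_bij_witness[where i = "\<lambda>i. i - 1" and j = "\<lambda>i. i + 1"]) auto
  also have "{1..<int N + 1} = insert (int N) {1..<int N}"
    using False by auto
  also have "(\<Sum>i\<in>\<dots>. u i) = u 0 + (\<Sum>i = 1..<int N. u i)"
    using assms[of 0] by simp
  also have "\<dots> = (\<Sum>i\<in>insert 0 {1..<int N}. u i)"
    by simp
  also have "insert 0 {1..<int N} = {0..<int N}"
    using False by auto
  finally show ?thesis .
qed simp

lemma abs_diff_le_sum_abs_increments:
  fixes u :: "int \<Rightarrow> real"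
  assumes "0 \<le> i" "i \<le> j" "j \<le> n"
  shows "\<bar>u i - u j\<bar> \<le> (\<Sum>k = 0..<n. \<bar>u k - u (k + 1)\<bar>)"
proof -
  have "\<bar>u i - u j\<bar> \<le> (\<Sum>k = i..<j. \<bar>u k - u (k + 1)\<bar>)"
    using \<open>i \<le> j\<close>
  proof (induction j rule: int_ge_induct)
    case (step j)
    have "{i..<j + 1} = insert j {i..<j}"
      using step.hyps by auto
    then show ?case
      using step.IH by simp
  qed simp
  also have "\<dots> \<le> (\<Sum>k = 0..<n. \<bar>u k - u (k + 1)\<bar>)"
    using assms by (intro sum_mono2) auto
  finally show ?thesis .
qed

text \<open>
  A function of mean zero is the average of its differences \<open>u i - u j\<close>, and each of these is at
  most the sum of the absolute increments, which Cauchy-Schwarz compares with the sum of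
  their squares. The constant is far from optimal, but any constant depending only
  on \<open>N\<close> gives a decay rate.
\<close>

lemma poincare_inequality_period:
  fixes u :: "int \<Rightarrow> real"
  assumes zero: "(\<Sum>i = 0..<int N. u i) = 0"
  shows "(\<Sum>i = 0..<int N. (u i)\<^sup>2) \<le> (real N)\<^sup>2 * (\<Sum>i = 0..<int N. (u i - u (i + 1))\<^sup>2)"
proof (cases "N = 0")
  case False
  define S where "S = (\<Sum>k = 0..<int N. \<bar>u k - u (k + 1)\<bar>)"
  define Q where "Q = (\<Sum>k = 0..<int N. (u k - u (k + 1))\<^sup>2)"
  have "S\<^sup>2 \<le> real N * Q"
    using sum_squared_le_sum_of_squares[of "\<lambda>k. \<bar>u k - u (k + 1)\<bar>" "{0..<int N}"]
    by (simp add: S_def Q_def mult.commute)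
  moreover have "\<bar>u i\<bar> \<le> S" if i: "i \<in> {0..<int N}" for i
  proof -
    have diff: "\<bar>u i - u j\<bar> \<le> S" if "j \<in> {0..<int N}" for j
      using i that abs_diff_le_sum_abs_increments[of i j "int N" u]
        abs_diff_le_sum_abs_increments[of j i "int N" u]
      by (cases "i \<le> j") (auto simp: S_def abs_minus_commute)
    have "real N * \<bar>u i\<bar> = \<bar>\<Sum>j = 0..<int N. u i - u j\<bar>"
      by (simp add: sum_subtractf zero abs_mult)
    also have "\<dots> \<le> (\<Sum>j = 0..<int N. S)"
      by (intro order_trans[OF sum_abs] sum_mono diff)
    finally show ?thesis
      using False by simp
  qed
  then have "(u i)\<^sup>2 \<le> S\<^sup>2" if "i \<in> {0..<int N}" for i
    using that by (metis abs_ge_zero power2_abs power_mono)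
  ultimately have "(u i)\<^sup>2 \<le> real N * Q" if "i \<in> {0..<int N}" for i
    using that by fastforce
  then have "(\<Sum>i = 0..<int N. (u i)\<^sup>2) \<le> (\<Sum>i = 0..<int N. real N * Q)"
    by (rule sum_mono)
  then show ?thesis
    by (simp add: Q_def power2_eq_square mult.assoc)
qed simp

section \<open>Energy decay for the linearised scheme\<close>

text \<open>
  The square on the left is \<open>(x - s p)\<^sup>2\<close> for \<open>p = (1 + q) (x - y) - q (y - z)\<close>. The differences
  \<open>x\<^sup>2 - y\<^sup>2\<close> and \<open>y\<^sup>2 - z\<^sup>2\<close> on the right are kept apart because they telescope to \<open>0\<close> over a
  period. The other terms of first order in \<open>s\<close> come from \<open>2 x (x - y) = (x - y)\<^sup>2 + x\<^sup>2 - y\<^sup>2\<close> and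
  its analogue for \<open>x (y - z)\<close>, with the mixed product \<open>(x - y) (y - z)\<close> bounded by squares. The
  constants \<open>9 / 2\<close> and \<open>1 / 2\<close> are \<open>2 (3 / 2)\<^sup>2\<close> and \<open>2 (1 / 2)\<^sup>2\<close>, from \<open>\<bar>1 + q\<bar> \<le> 3 / 2\<close> and
  \<open>\<bar>q\<bar> \<le> 1 / 2\<close>.
\<close>

lemma pointwise_energy_inequality:
  fixes s q x y z :: real
  assumes "s \<ge> 0" and "\<bar>q\<bar> \<le> 1 / 2"
  shows "((1 - s * (1 + q)) * x + s * (1 + 2 * q) * y - s * q * z)\<^sup>2 \<le>
    x\<^sup>2 - s * (1 + q) * (x\<^sup>2 - y\<^sup>2) + s * q * (y\<^sup>2 - z\<^sup>2)
      - s * (1 + q - \<bar>q\<bar>) * (x - y)\<^sup>2 + s * (q + \<bar>q\<bar>) * (y - z)\<^sup>2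
      + s\<^sup>2 * (9 / 2 * (x - y)\<^sup>2 + 1 / 2 * (y - z)\<^sup>2)"
proof -
  define d e p where "d = x - y" and "e = y - z" and "p = (1 + q) * d - q * e"
  have "2 * (q * d * e) \<le> \<bar>q\<bar> * (d\<^sup>2 + e\<^sup>2)"
  proof -
    have "2 * (q * d * e) \<le> \<bar>q\<bar> * \<bar>2 * d * e\<bar>"
      by (simp add: abs_mult[symmetric])
    also have "\<bar>2 * d * e\<bar> \<le> d\<^sup>2 + e\<^sup>2"
      using sum_squares_bound[of "\<bar>d\<bar>" "\<bar>e\<bar>"] by (simp add: abs_mult)
    finally show ?thesis
      by (simp add: mult_left_mono)
  qed
  then have cross: "s * (2 * (q * d * e)) \<le> s * (\<bar>q\<bar> * (d\<^sup>2 + e\<^sup>2))"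
    using \<open>s \<ge> 0\<close> by (rule mult_left_mono)
  have "p\<^sup>2 \<le> 2 * ((1 + q) * d)\<^sup>2 + 2 * (q * e)\<^sup>2"
    using zero_le_power2[of "(1 + q) * d + q * e"]
    by (simp add: p_def power2_sum power2_diff)
  also have "\<dots> \<le> 9 / 2 * d\<^sup>2 + 1 / 2 * e\<^sup>2"
  proof -
    have "(1 + q)\<^sup>2 \<le> (3 / 2)\<^sup>2" "q\<^sup>2 \<le> (1 / 2)\<^sup>2"
      using assms(2) by (auto intro!: power2_le_iff_abs_le[THEN iffD2])
    then have "(1 + q)\<^sup>2 * d\<^sup>2 \<le> 9 / 4 * d\<^sup>2" "q\<^sup>2 * e\<^sup>2 \<le> 1 / 4 * e\<^sup>2"
      using mult_right_mono[of "(1 + q)\<^sup>2" "9 / 4" "d\<^sup>2"] mult_right_mono[of "q\<^sup>2" "1 / 4" "e\<^sup>2"]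
      by (simp_all add: power_divide)
    then show ?thesis
      by (simp add: power_mult_distrib)
  qed
  finally have square: "s\<^sup>2 * p\<^sup>2 \<le> s\<^sup>2 * (9 / 2 * d\<^sup>2 + 1 / 2 * e\<^sup>2)"
    by (rule mult_left_mono) simp
  have "((1 - s * (1 + q)) * x + s * (1 + 2 * q) * y - s * q * z)\<^sup>2 =
    x\<^sup>2 - s * (1 + q) * (x\<^sup>2 - y\<^sup>2) + s * q * (y\<^sup>2 - z\<^sup>2)
      - s * (1 + q) * d\<^sup>2 + s * q * e\<^sup>2 + s * (2 * (q * d * e)) + s\<^sup>2 * p\<^sup>2"
    by (simp add: d_def e_def p_def power2_eq_square algebra_simps)
  with cross square show ?thesis
    by (simp add: d_def[symmetric] e_def[symmetric] algebra_simps)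
qed

lemma energy_dissipation:
  fixes u v :: "int \<Rightarrow> real" and s q :: real
  assumes "s \<ge> 0" and "\<bar>q\<bar> \<le> 1 / 2"
    and periodic: "\<And>i. u (i + int N) = u i"
    and step: "\<And>i. v i = (1 - s * (1 + q)) * u i + s * (1 + 2 * q) * u (i + 1) - s * q * u (i + 2)"
  shows "(\<Sum>i = 0..<int N. (v i)\<^sup>2) \<le> (\<Sum>i = 0..<int N. (u i)\<^sup>2)
    - s * (1 - 2 * \<bar>q\<bar> - 5 * s) * (\<Sum>i = 0..<int N. (u i - u (i + 1))\<^sup>2)"
proof -
  define E where "E = (\<Sum>i = 0..<int N. (u i)\<^sup>2)"
  define Q where "Q = (\<Sum>i = 0..<int N. (u i - u (i + 1))\<^sup>2)"
  have per: "u (i + int N + 1) = u (i + 1)" "u (i + int N + 2) = u (i + 2)" for i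
    using periodic[of "i + 1"] periodic[of "i + 2"] by (simp_all add: algebra_simps)
  have E1: "(\<Sum>i = 0..<int N. (u (i + 1))\<^sup>2) = E"
    using sum_period_shift[of "\<lambda>i. (u i)\<^sup>2"] by (simp add: E_def periodic)
  have E2: "(\<Sum>i = 0..<int N. (u (i + 2))\<^sup>2) = E"
    using sum_period_shift[of "\<lambda>i. (u (i + 1))\<^sup>2" N] E1 per by (simp add: add.assoc)
  have Q1: "(\<Sum>i = 0..<int N. (u (i + 1) - u (i + 2))\<^sup>2) = Q"
    using sum_period_shift[of "\<lambda>i. (u i - u (i + 1))\<^sup>2" N] per
    by (simp add: Q_def periodic add.assoc)
  have "(\<Sum>i = 0..<int N. (v i)\<^sup>2) \<le> (\<Sum>i = 0..<int N.
      (u i)\<^sup>2 - s * (1 + q) * ((u i)\<^sup>2 - (u (i + 1))\<^sup>2) + s * q * ((u (i + 1))\<^sup>2 - (u (i + 2))\<^sup>2)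
      - s * (1 + q - \<bar>q\<bar>) * (u i - u (i + 1))\<^sup>2 + s * (q + \<bar>q\<bar>) * (u (i + 1) - u (i + 2))\<^sup>2
      + s\<^sup>2 * (9 / 2 * (u i - u (i + 1))\<^sup>2 + 1 / 2 * (u (i + 1) - u (i + 2))\<^sup>2))"
    unfolding step by (intro sum_mono pointwise_energy_inequality assms)
  also have "\<dots> = E - s * (1 + q) * (E - E) + s * q * (E - E)
      - s * (1 + q - \<bar>q\<bar>) * Q + s * (q + \<bar>q\<bar>) * Q + s\<^sup>2 * (9 / 2 * Q + 1 / 2 * Q)"
    by (simp only: sum.distrib sum_subtractf sum_distrib_left[symmetric] E1 E2 Q1
        E_def[symmetric] Q_def[symmetric])
  also have "\<dots> = E - s * (1 - 2 * \<bar>q\<bar> - 5 * s) * Q"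
    by (simp add: power2_eq_square algebra_simps)
  finally show ?thesis
    by (simp add: E_def Q_def)
qed

lemma linearised_solution_tendsto_0:
  assumes "0 < s" and "5 * s < 1 - 2 * \<bar>q\<bar>" and "N > 0"
    and sol: "linearised_solution N (1 - s * (1 + q)) (s * (1 + 2 * q)) (- (s * q)) 0 \<epsilon>"
    and zero: "(\<Sum>i = 0..<int N. \<epsilon> 0 i) = 0"
  shows "(\<lambda>k. \<epsilon> k i) \<longlonglongrightarrow> 0"
proof -
  have periodic: "\<epsilon> k (i + int N) = \<epsilon> k i" for k i
    using sol by (simp add: linearised_solution_def)
  have step: "\<epsilon> (Suc k) i =
      (1 - s * (1 + q)) * \<epsilon> k i + s * (1 + 2 * q) * \<epsilon> k (i + 1) - s * q * \<epsilon> k (i + 2)" for k i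
    using sol by (simp add: linearised_solution_def)
  have mass: "(\<Sum>i = 0..<int N. \<epsilon> k i) = 0" for k
  proof (induction k)
    case (Suc k)
    have "\<epsilon> k (i + int N + 1) = \<epsilon> k (i + 1)" for i
      using periodic[of k "i + 1"] by (simp add: algebra_simps)
    then have "(\<Sum>i = 0..<int N. \<epsilon> k (i + 1)) = 0" "(\<Sum>i = 0..<int N. \<epsilon> k (i + 2)) = 0"
      using sum_period_shift[of "\<epsilon> k" N] sum_period_shift[of "\<lambda>i. \<epsilon> k (i + 1)" N] Suc.IH
      by (simp_all add: periodic add.commute)
    then show ?case
      by (simp add: step sum.distrib sum_subtractf sum_distrib_left[symmetric] Suc.IH)
  qed (rule zero)
  define E where "E k = (\<Sum>i = 0..<int N. (\<epsilon> k i)\<^sup>2)" for k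
  define c where "c = s * (1 - 2 * \<bar>q\<bar> - 5 * s)"
  \<comment> \<open>The maximum with \<open>0\<close> lets the estimate be iterated without bounding \<open>c\<close> from above.\<close>
  define r where "r = max 0 (1 - c / (real N)\<^sup>2)"
  have "c > 0"
    using assms by (simp add: c_def)
  then have "0 \<le> r" "r < 1"
    using \<open>N > 0\<close> by (simp_all add: r_def)
  have E_nonneg: "E k \<ge> 0" for k
    by (simp add: E_def sum_nonneg)
  have E_Suc: "E (Suc k) \<le> r * E k" for k
  proof -
    define Q where "Q = (\<Sum>i = 0..<int N. (\<epsilon> k i - \<epsilon> k (i + 1))\<^sup>2)"
    have "E k \<le> (real N)\<^sup>2 * Q"
      unfolding E_def Q_def by (rule poincare_inequality_period[OF mass])
    then have "c * (E k / (real N)\<^sup>2) \<le> c * Q"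
      using \<open>c > 0\<close> \<open>N > 0\<close> by (intro mult_left_mono) (simp_all add: field_simps)
    moreover have "E (Suc k) \<le> E k - c * Q"
      unfolding E_def Q_def c_def using assms
      by (intro energy_dissipation periodic step) auto
    ultimately have "E (Suc k) \<le> (1 - c / (real N)\<^sup>2) * E k"
      by (simp add: algebra_simps)
    also have "\<dots> \<le> r * E k"
      using E_nonneg by (intro mult_right_mono) (simp_all add: r_def)
    finally show ?thesis .
  qed
  have E_le: "E k \<le> r ^ k * E 0" for k
  proof (induction k)
    case (Suc k)
    have "r * E k \<le> r * (r ^ k * E 0)"
      using Suc \<open>0 \<le> r\<close> by (rule mult_left_mono)
    with E_Suc[of k] show ?case
      by (simp add: mult.assoc)
  qed simp
  have E_lim: "E \<longlonglongrightarrow> 0"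
  proof (rule tendsto_sandwich[OF _ _ tendsto_const])
    show "(\<lambda>k. r ^ k * E 0) \<longlonglongrightarrow> 0"
      using LIMSEQ_realpow_zero[OF \<open>0 \<le> r\<close> \<open>r < 1\<close>] by (rule tendsto_mult_left_zero)
  qed (auto intro!: always_eventually E_nonneg E_le)
  have "(\<epsilon> k i)\<^sup>2 \<le> E k" for k
  proof -
    interpret periodic_fun_simple "\<epsilon> k" "int N"
      by unfold_locales (rule periodic)
    have "\<epsilon> k i = \<epsilon> k (i mod int N)"
      using plus_of_int[of "i mod int N" "i div int N"] by (simp add: mult.commute)
    moreover have "(\<epsilon> k (i mod int N))\<^sup>2 \<le> E k"
      unfolding E_def using \<open>N > 0\<close> by (intro member_le_sum) auto
    ultimately show ?thesis
      by simp
  qed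
  then have "(\<lambda>k. (\<epsilon> k i)\<^sup>2) \<longlonglongrightarrow> 0"
    by (intro tendsto_sandwich[OF _ _ tendsto_const E_lim]) auto
  then show ?thesis
    by (simp add: power_tendsto_0_iff)
qed

section \<open>Linearisation of the two flows\<close>

text \<open>
  Here \<open>- m\<close> is the slope of the equilibrium flow \<open>f \<rho> \<rho> \<rho>\<close>, and \<open>q\<close> is the share of the
  second downstream cell relative to \<open>m\<close>.
  With \<open>s = (\<delta>t / \<delta>x) m\<close>, differences of the partial derivatives of \<open>f\<close> give
  the coefficients that the decay estimate is stated for.
\<close>

lemma linearly_stable_scheme_map:
  fixes f :: "real \<Rightarrow> real \<Rightarrow> real \<Rightarrow> real"
  assumes fx: "((\<lambda>x. f x \<rho> \<rho>) has_real_derivative 0) (at \<rho>)"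
    and fy: "((\<lambda>y. f \<rho> y \<rho>) has_real_derivative - m * (1 + q)) (at \<rho>)"
    and fz: "((\<lambda>z. f \<rho> \<rho> z) has_real_derivative m * q) (at \<rho>)"
    and "0 < \<delta>t / \<delta>x * m" and "5 * (\<delta>t / \<delta>x * m) < 1 - 2 * \<bar>q\<bar>" and "N > 0"
  shows "linearly_stable N (scheme_map f \<delta>t \<delta>x) \<rho>"
proof -
  define s where "s = \<delta>t / \<delta>x * m"
  have "((\<lambda>x. scheme_map f \<delta>t \<delta>x x \<rho> \<rho> \<rho>) has_real_derivative 1 - s * (1 + q)) (at \<rho>)"
    unfolding scheme_map_def s_def
    by (rule derivative_eq_intros fx fy fz refl | simp add: algebra_simps add_divide_distrib)+
  moreover have "((\<lambda>x. scheme_map f \<delta>t \<delta>x \<rho> x \<rho> \<rho>) has_real_derivative s * (1 + 2 * q)) (at \<rho>)"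
    unfolding scheme_map_def s_def
    by (rule derivative_eq_intros fx fy fz refl | simp add: algebra_simps add_divide_distrib)+
  moreover have "((\<lambda>x. scheme_map f \<delta>t \<delta>x \<rho> \<rho> x \<rho>) has_real_derivative - (s * q)) (at \<rho>)"
    unfolding scheme_map_def s_def
    by (rule derivative_eq_intros fx fy fz refl | simp add: algebra_simps add_divide_distrib)+
  moreover have "((\<lambda>x. scheme_map f \<delta>t \<delta>x \<rho> \<rho> \<rho> x) has_real_derivative 0) (at \<rho>)"
    unfolding scheme_map_def s_def
    by (rule derivative_eq_intros fx fy fz refl | simp add: algebra_simps add_divide_distrib)+
  ultimately show ?thesis
    unfolding linearly_stable_def
    using linearised_solution_tendsto_0[of s q N] assms(4-6) unfolding s_def by blast
qed

lemma optimal_speed_has_derivative: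
  assumes "T \<noteq> 0" and "\<rho> \<noteq> 0"
  shows "(optimal_speed T l has_real_derivative - (1 / (T * \<rho>\<^sup>2))) (at \<rho>)"
  unfolding optimal_speed_def using assms
  by (auto intro!: derivative_eq_intros simp: power2_eq_square)

lemma godunov_godunov_flow_partials:
  fixes T l \<tau> \<delta>x \<rho> :: real
  assumes "T \<noteq> 0" and "\<rho> \<noteq> 0"
  defines "f \<equiv> godunov_godunov_flow (optimal_speed T l) (godunov_flux T l) \<tau> \<delta>x"
    and "q \<equiv> \<tau> / (\<delta>x * T * \<rho>)"
  shows "((\<lambda>x. f x \<rho> \<rho>) has_real_derivative 0) (at \<rho>)"
    and "((\<lambda>y. f \<rho> y \<rho>) has_real_derivative - (l / T) * (1 + q)) (at \<rho>)"
    and "((\<lambda>z. f \<rho> \<rho> z) has_real_derivative l / T * q) (at \<rho>)"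
proof -
  \<comment> \<open>When \<open>y\<close> or \<open>z\<close> varies, \<open>V'\<close> stays evaluated at \<open>\<rho>\<close>; when \<open>x\<close> varies, its factor is \<open>0\<close>.
    So this one value of the derivative suffices.\<close>
  have dV: "deriv (optimal_speed T l) \<rho> = - (1 / (T * \<rho>\<^sup>2))"
    using optimal_speed_has_derivative[OF assms(1,2)] by (rule DERIV_imp_deriv)
  show "((\<lambda>x. f x \<rho> \<rho>) has_real_derivative 0) (at \<rho>)"
    by (simp add: f_def godunov_godunov_flow_def godunov_flux_def)
  define \<kappa> where "\<kappa> = \<tau> / \<delta>x"
  have q: "q = \<kappa> / (T * \<rho>)"
    by (simp add: q_def \<kappa>_def)
  show "((\<lambda>y. f \<rho> y \<rho>) has_real_derivative - (l / T) * (1 + q)) (at \<rho>)"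
    unfolding f_def godunov_godunov_flow_def godunov_flux_def dV q \<kappa>_def[symmetric]
    by (rule derivative_eq_intros refl | simp add: assms(1,2) field_simps power2_eq_square)+
  show "((\<lambda>z. f \<rho> \<rho> z) has_real_derivative l / T * q) (at \<rho>)"
    unfolding f_def godunov_godunov_flow_def godunov_flux_def dV q \<kappa>_def[symmetric]
    by (rule derivative_eq_intros refl | simp add: assms(1,2) field_simps power2_eq_square)+
qed

lemma godunov_flow_partials:
  fixes T l \<tau> \<delta>x \<rho> :: real
  assumes "T \<noteq> 0" and "\<rho> \<noteq> 0"
  defines "f \<equiv> godunov_flow (optimal_speed T l) (godunov_flux T l) \<tau> \<delta>x"
    and "q \<equiv> \<tau> / (\<delta>x * T * \<rho>)"
  shows "((\<lambda>x. f x \<rho> \<rho>) has_real_derivative 0) (at \<rho>)"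
    and "((\<lambda>y. f \<rho> y \<rho>) has_real_derivative - (l / T) * (1 + q)) (at \<rho>)"
    and "((\<lambda>z. f \<rho> \<rho> z) has_real_derivative l / T * q) (at \<rho>)"
proof -
  note dV = optimal_speed_has_derivative[OF assms(1,2), of l]
  show "((\<lambda>x. f x \<rho> \<rho>) has_real_derivative 0) (at \<rho>)"
    by (simp add: f_def godunov_flow_def godunov_flux_def)
  define \<kappa> where "\<kappa> = \<tau> / \<delta>x"
  have q: "q = \<kappa> / (T * \<rho>)"
    by (simp add: q_def \<kappa>_def)
  show "((\<lambda>y. f \<rho> y \<rho>) has_real_derivative - (l / T) * (1 + q)) (at \<rho>)"
    unfolding f_def godunov_flow_def godunov_flux_def q \<kappa>_def[symmetric]
    by (rule derivative_eq_intros refl dV | simp add: assms(1,2) field_simps power2_eq_square)+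
  show "((\<lambda>z. f \<rho> \<rho> z) has_real_derivative l / T * q) (at \<rho>)"
    unfolding f_def godunov_flow_def godunov_flux_def q \<kappa>_def[symmetric]
    by (rule derivative_eq_intros refl dV | simp add: assms(1,2) field_simps power2_eq_square)+
qed

theorem lemma3p4:
  fixes T l \<tau> \<delta>x \<rho>e :: real and N :: nat
  assumes "T > 0" and "l > 0" and "\<delta>x > 0" and "\<rho>e > 0" and "N \<ge> 2"
    and "2 * \<bar>\<tau>\<bar> < T * \<delta>x * \<rho>e"
  shows "\<exists>\<delta>t0>0. \<forall>\<delta>t\<in>{0<..<\<delta>t0}.
           linearly_stable N
             (scheme_map (godunov_godunov_flow (optimal_speed T l) (godunov_flux T l) \<tau> \<delta>x) \<delta>t \<delta>x) \<rho>e \<and>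
           linearly_stable N
             (scheme_map (godunov_flow (optimal_speed T l) (godunov_flux T l) \<tau> \<delta>x) \<delta>t \<delta>x) \<rho>e"
proof -
  define q where "q = \<tau> / (\<delta>x * T * \<rho>e)"
  \<comment> \<open>The largest value for which \<open>5 s < 1 - 2 \<bar>q\<bar>\<close> holds below it, where \<open>s = \<delta>t l / (\<delta>x T)\<close>.\<close>
  define \<delta>t0 where "\<delta>t0 = (1 - 2 * \<bar>q\<bar>) * \<delta>x * T / (5 * l)"
  have q: "2 * \<bar>q\<bar> < 1"
    using assms by (simp add: q_def abs_mult field_simps)
  then have "\<delta>t0 > 0"
    using assms by (simp add: \<delta>t0_def)
  moreover have "linearly_stable N
        (scheme_map (godunov_godunov_flow (optimal_speed T l) (godunov_flux T l) \<tau> \<delta>x) \<delta>t \<delta>x) \<rho>e \<and>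
      linearly_stable N
        (scheme_map (godunov_flow (optimal_speed T l) (godunov_flux T l) \<tau> \<delta>x) \<delta>t \<delta>x) \<rho>e"
    if "\<delta>t \<in> {0<..<\<delta>t0}" for \<delta>t
  proof -
    have small: "0 < \<delta>t / \<delta>x * (l / T)" "5 * (\<delta>t / \<delta>x * (l / T)) < 1 - 2 * \<bar>q\<bar>"
      using that assms by (simp_all add: \<delta>t0_def field_simps)
    have "T \<noteq> 0" "\<rho>e \<noteq> 0" "N > 0"
      using assms by auto
    note gg = godunov_godunov_flow_partials[OF \<open>T \<noteq> 0\<close> \<open>\<rho>e \<noteq> 0\<close>, of l \<tau> \<delta>x, folded q_def]
      and g = godunov_flow_partials[OF \<open>T \<noteq> 0\<close> \<open>\<rho>e \<noteq> 0\<close>, of l \<tau> \<delta>x, folded q_def]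
    show ?thesis
      using linearly_stable_scheme_map[OF gg small \<open>N > 0\<close>]
        linearly_stable_scheme_map[OF g small \<open>N > 0\<close>] by blast
  qed
  ultimately show ?thesis
    by blast
qed

end
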